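(* Let $k\ge 2$ and $q\ge 2$ be integers, let $K=kq$ be the number of servers, let $Q$ be a positive multiple of $K$, let $N=q^{k-1}$ be the number of subfiles, and let $B$ be a positive integer divisible by $k-1$. Consider the coded distributed computing protocol described in the context, with any choice of the equal-size partition of $[Q]$ among the servers and any choice of the edge labelings. Then: (i) the computation load is $r=k$, i.e., every subfile is assigned to exactly $k$ servers; (ii) for every choice of intermediate values $\nu_{j,n}\in\{0,1\}^B$ ($j\in[Q]$, $n\in[N]$), at the end of the shuffle phase every server $B_{i,l}$ can recover, from the intermediate values it computed itself in the map phase and the transmissions of the other servers in the groups to which it belongs, all intermediate values $\nu_{j,n}$ with $j\in\phi^{B_{i,l}}$ and $n\in[N]$; (iii) the communication load of the protocol is $$L=\frac{1}{k-1}\left(1-\frac{k}{K}\right).$$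
   Context: Notation: $[n]=\{1,\dots,n\}$, and $\mathbb{Z}_q$ is the ring of integers modulo $q$ ($q$ need not be prime). **Computing model.** A file is split into $N$ disjoint subfiles $w_1,\dots,w_N$, and $Q$ functions of the whole file are to be computed by $K$ servers. For each $j\in[Q]$ and $n\in[N]$ there is an intermediate value $\nu_{j,n}\in\{0,1\}^B$, and the $j$-th output function is determined by $\nu_{j,1},\dots,\nu_{j,N}$. Each server is assigned a set of subfiles. In the map phase a server computes $\nu_{j,n}$ for all $j\in[Q]$ and all subfiles $w_n$ assigned to it. Each server is also assigned a set of functions that it must reduce, and these sets partition $[Q]$. To reduce function $j$, a server needs $\nu_{j,n}$ for all $n\in[N]$. In the shuffle phase servers send messages to one another, each message depending only on the intermediate values computed by its sender. The computation load $r$ is the number of servers to which each subfile is assigned. The communication load $L$ is the total number of bits transmitted in the shuffle phase divided by $QNB$, where a message multicast to several servers is counted once. **Block design.** Let $\mathbf{G}_{SPC}=[\,\mathbf{I}_{k-1}\mid \mathbf{1}\,]$ be the $(k-1)\times k$ matrix over $\mathbb{Z}_q$ consisting of the identity matrix followed by an all-ones column. Let $\mathbf{T}$ be the $k\times q^{k-1}$ matrix whose columns are the transposes of the $q^{k-1}$ codewords $\mathbf{u}\,\mathbf{G}_{SPC}$, $\mathbf{u}\in\mathbb{Z}_q^{k-1}$, listed in some fixed order. For $1\le i\le k$ and $0\le l\le q-1$ let $$B_{i,l}=\{j\in[q^{k-1}]:\mathbf{T}_{i,j}=l\}.$$ **Protocol.** 1. There are $N=q^{k-1}$ subfiles, and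 the $K=kq$ servers are identified with the blocks $B_{i,l}$. Server $B_{i,l}$ is assigned subfile $w_n$ if and only if $n\in B_{i,l}$. 2. The set $[Q]$ is partitioned into sets $\phi^{B_{i,l}}$ of equal size $Q/K$. Server $B_{i,l}$ must reduce the functions in $\phi^{B_{i,l}}$, and $\phi^{B_{i,l}}[\gamma]$ denotes the $\gamma$-th element of $\phi^{B_{i,l}}$, $\gamma\in[Q/K]$. 3. Let $\mathcal{G}$ be the collection of all groups $G=\{B_{1,j_1},B_{2,j_2},\dots,B_{k,j_k}\}$ with $j_\ell\in\{0,\dots,q-1\}$ such that $\bigcap_{\ell=1}^k B_{\ell,j_\ell}=\emptyset$. For such a group, each set $\bigcap_{m\ne \ell}B_{m,j_m}$ ($\ell\in[k]$) consists of exactly one element. 4. Shuffle phase. For every $\gamma\in[Q/K]$ and every $G=\{B_{1,j_1},\dots,B_{k,j_k}\}\in\mathcal{G}$, put $$\Delta^G_\ell=\nu_{\phi^{B_{\ell,j_\ell}}[\gamma],\,n_\ell},\qquad \text{where } \{n_\ell\}=\bigcap_{m\neq \ell}B_{m,j_m},\qquad \ell\in[k].$$ Split each $\Delta^G_\ell$ into $k-1$ consecutive parts $\Delta^G_\ell[1],\dots,\Delta^G_\ell[k-1]$ of $B/(k-1)$ bits each. For each $\ell\in[k]$, choose a bijection $\mathrm{label}(\Delta^G_\ell,\cdot):G\setminus\{B_{\ell,j_\ell}\}\to\{1,\dots,k-1\}$ (known to all servers). Then each server $B_{\ell,j_\ell}\in G$ multicasts to the other servers of $G$ the $B/(k-1)$-bit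 message $$\bigoplus_{m\in[k],\,m\ne\ell}\Delta^G_m\big[\mathrm{label}(\Delta^G_m,B_{\ell,j_\ell})\big],$$ where $\oplus$ is bitwise XOR. *)

theory Defs
  imports Complex_Main "HOL-Library.FuncSet" "HOL-Library.Disjoint_Sets" "HOL-Library.Z2"
begin

text \<open>
  Elements of the integers modulo \<open>q\<close> are represented by their residues \<open>{0..<q}\<close>.
  All other indices are 1-based. The server holding the block \<open>B\<^sub>i\<^sub>,\<^sub>l\<close> is the pair
  \<open>(i, l)\<close>: for \<open>k = 2\<close> the blocks \<open>B\<^sub>1\<^sub>,\<^sub>l\<close> and \<open>B\<^sub>2\<^sub>,\<^sub>l\<close> are equal as sets, so the
  sets themselves cannot serve as names for \<open>k * q\<close> servers.
\<close>

type_synonym server = "nat \<times> nat"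

definition servers :: "nat \<Rightarrow> nat \<Rightarrow> server set" where
  "servers k q = {1..k} \<times> {0..<q}"

definition spc_gen :: "nat \<Rightarrow> nat \<Rightarrow> nat \<Rightarrow> nat" where
  "spc_gen k a i = (if i = k then 1 else if a = i then 1 else 0)"

definition info_vectors :: "nat \<Rightarrow> nat \<Rightarrow> (nat \<Rightarrow> nat) set" where
  "info_vectors k q = ({1..k-1} \<rightarrow>\<^sub>E {0..<q})"

definition codeword :: "nat \<Rightarrow> nat \<Rightarrow> (nat \<Rightarrow> nat) \<Rightarrow> nat \<Rightarrow> nat" where
  "codeword k q u i = (\<Sum>a\<in>{1..k-1}. u a * spc_gen k a i) mod q"

text \<open>
  \<open>ord\<close> is the order in which the codewords are listed: column \<open>j\<close> of the matrix is the
  codeword of the information vector \<open>ord j\<close>.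
\<close>

definition code_matrix :: "nat \<Rightarrow> nat \<Rightarrow> (nat \<Rightarrow> nat \<Rightarrow> nat) \<Rightarrow> nat \<Rightarrow> nat \<Rightarrow> nat" where
  "code_matrix k q ord i j = codeword k q (ord j) i"

definition block :: "nat \<Rightarrow> nat \<Rightarrow> (nat \<Rightarrow> nat \<Rightarrow> nat) \<Rightarrow> server \<Rightarrow> nat set" where
  "block k q ord = (\<lambda>(i, l). {j \<in> {1..q^(k-1)}. code_matrix k q ord i j = l})"

definition assigned_servers :: "nat \<Rightarrow> nat \<Rightarrow> (nat \<Rightarrow> nat \<Rightarrow> nat) \<Rightarrow> nat \<Rightarrow> server set" where
  "assigned_servers k q ord n = {s \<in> servers k q. n \<in> block k q ord s}"

text \<open>The group with members \<open>(1, G 1), \<dots>, (k, G k)\<close> is represented by the index tuple \<open>G\<close>.\<close>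

definition members :: "nat \<Rightarrow> (nat \<Rightarrow> nat) \<Rightarrow> server set" where
  "members k G = (\<lambda>i. (i, G i)) ` {1..k}"

definition groups :: "nat \<Rightarrow> nat \<Rightarrow> (nat \<Rightarrow> nat \<Rightarrow> nat) \<Rightarrow> (nat \<Rightarrow> nat) set" where
  "groups k q ord =
     {G \<in> {1..k} \<rightarrow>\<^sub>E {0..<q}. (\<Inter>i\<in>{1..k}. block k q ord (i, G i)) = {}}"

text \<open>
  Choices that are left open by the protocol. \<open>phi s\<close> is the set of functions reduced by \<open>s\<close>
  and \<open>elt s \<gamma>\<close> is its \<open>\<gamma>\<close>-th element; \<open>lab \<gamma> G l\<close> is the labeling attached to the \<open>l\<close>-th
  requested value of the group \<open>G\<close> in round \<open>\<gamma>\<close>.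
\<close>

definition reduce_assignment ::
  "nat \<Rightarrow> nat \<Rightarrow> nat \<Rightarrow> (server \<Rightarrow> nat set) \<Rightarrow> (server \<Rightarrow> nat \<Rightarrow> nat) \<Rightarrow> bool" where
  "reduce_assignment k q Q phi elt \<longleftrightarrow>
     disjoint_family_on phi (servers k q) \<and>
     (\<Union>s\<in>servers k q. phi s) = {1..Q} \<and>
     (\<forall>s\<in>servers k q. card (phi s) = Q div (k*q) \<and>
                       bij_betw (elt s) {1..Q div (k*q)} (phi s))"

definition edge_labeling ::
  "nat \<Rightarrow> nat \<Rightarrow> nat \<Rightarrow> (nat \<Rightarrow> nat \<Rightarrow> nat) \<Rightarrow>
   (nat \<Rightarrow> (nat \<Rightarrow> nat) \<Rightarrow> nat \<Rightarrow> server \<Rightarrow> nat) \<Rightarrow> bool" where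
  "edge_labeling k q Q ord lab \<longleftrightarrow>
     (\<forall>\<gamma>\<in>{1..Q div (k*q)}. \<forall>G\<in>groups k q ord. \<forall>l\<in>{1..k}.
        bij_betw (lab \<gamma> G l) (members k G - {(l, G l)}) {1..k-1})"

type_synonym ivalues = "nat \<times> nat \<Rightarrow> bit list"

definition intermediate_values :: "nat \<Rightarrow> nat \<Rightarrow> nat \<Rightarrow> nat \<Rightarrow> ivalues set" where
  "intermediate_values k q Q B =
     {\<nu>. \<forall>j\<in>{1..Q}. \<forall>n\<in>{1..q^(k-1)}. length (\<nu> (j, n)) = B}"

text \<open>
  The values known to a server after the map phase; \<open>restrict\<close> makes the table constantly
  \<open>undefined\<close> elsewhere, so it carries no further information about \<open>\<nu>\<close>.
\<close>

definition map_phase ::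
  "nat \<Rightarrow> nat \<Rightarrow> nat \<Rightarrow> (nat \<Rightarrow> nat \<Rightarrow> nat) \<Rightarrow> server \<Rightarrow> ivalues \<Rightarrow> ivalues" where
  "map_phase k q Q ord s \<nu> = restrict \<nu> ({1..Q} \<times> block k q ord s)"

definition delta_index ::
  "nat \<Rightarrow> nat \<Rightarrow> (nat \<Rightarrow> nat \<Rightarrow> nat) \<Rightarrow> (server \<Rightarrow> nat \<Rightarrow> nat) \<Rightarrow>
   nat \<Rightarrow> (nat \<Rightarrow> nat) \<Rightarrow> nat \<Rightarrow> nat \<times> nat" where
  "delta_index k q ord elt \<gamma> G l =
     (elt (l, G l) \<gamma>, the_elem (\<Inter>m\<in>{1..k} - {l}. block k q ord (m, G m)))"

definition part :: "nat \<Rightarrow> nat \<Rightarrow> 'a list \<Rightarrow> 'a list" where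
  "part b p v = take b (drop ((p - 1) * b) v)"

text \<open>
  The message of the \<open>l\<close>-th member of \<open>G\<close>, computed from a table \<open>\<mu>\<close> of intermediate values;
  addition of bits is exclusive or. The message actually sent is computed from the table
  \<open>map_phase\<close> of the sender, so it depends only on values the sender knows.
\<close>

definition message ::
  "nat \<Rightarrow> nat \<Rightarrow> nat \<Rightarrow> (nat \<Rightarrow> nat \<Rightarrow> nat) \<Rightarrow> (server \<Rightarrow> nat \<Rightarrow> nat) \<Rightarrow>
   (nat \<Rightarrow> (nat \<Rightarrow> nat) \<Rightarrow> nat \<Rightarrow> server \<Rightarrow> nat) \<Rightarrow>
   nat \<Rightarrow> (nat \<Rightarrow> nat) \<Rightarrow> nat \<Rightarrow> ivalues \<Rightarrow> bit list" where
  "message k q B ord elt lab \<gamma> G l \<mu> =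
     map (\<lambda>t. \<Sum>m\<in>{1..k} - {l}.
            part (B div (k-1)) (lab \<gamma> G m (l, G l)) (\<mu> (delta_index k q ord elt \<gamma> G m)) ! t)
         [0..<B div (k-1)]"

text \<open>The transmission \<open>(\<gamma>, G, l)\<close> is the multicast by member \<open>l\<close> of group \<open>G\<close> in round \<open>\<gamma>\<close>.\<close>

type_synonym transmission = "nat \<times> (nat \<Rightarrow> nat) \<times> nat"

definition transmissions ::
  "nat \<Rightarrow> nat \<Rightarrow> nat \<Rightarrow> (nat \<Rightarrow> nat \<Rightarrow> nat) \<Rightarrow> transmission set" where
  "transmissions k q Q ord = {1..Q div (k*q)} \<times> groups k q ord \<times> {1..k}"

definition sent ::
  "nat \<Rightarrow> nat \<Rightarrow> nat \<Rightarrow> nat \<Rightarrow> (nat \<Rightarrow> nat \<Rightarrow> nat) \<Rightarrow> (server \<Rightarrow> nat \<Rightarrow> nat) \<Rightarrow>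
   (nat \<Rightarrow> (nat \<Rightarrow> nat) \<Rightarrow> nat \<Rightarrow> server \<Rightarrow> nat) \<Rightarrow> ivalues \<Rightarrow> transmission \<Rightarrow> bit list" where
  "sent k q Q B ord elt lab \<nu> =
     (\<lambda>(\<gamma>, G, l). message k q B ord elt lab \<gamma> G l (map_phase k q Q ord (l, G l) \<nu>))"

definition received ::
  "nat \<Rightarrow> nat \<Rightarrow> nat \<Rightarrow> nat \<Rightarrow> (nat \<Rightarrow> nat \<Rightarrow> nat) \<Rightarrow> (server \<Rightarrow> nat \<Rightarrow> nat) \<Rightarrow>
   (nat \<Rightarrow> (nat \<Rightarrow> nat) \<Rightarrow> nat \<Rightarrow> server \<Rightarrow> nat) \<Rightarrow> server \<Rightarrow> ivalues \<Rightarrow>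
   transmission \<Rightarrow> bit list" where
  "received k q Q B ord elt lab s \<nu> =
     restrict (sent k q Q B ord elt lab \<nu>)
       {(\<gamma>, G, l) \<in> transmissions k q Q ord. s \<in> members k G \<and> s \<noteq> (l, G l)}"

definition communication_load ::
  "nat \<Rightarrow> nat \<Rightarrow> nat \<Rightarrow> nat \<Rightarrow> (nat \<Rightarrow> nat \<Rightarrow> nat) \<Rightarrow> (server \<Rightarrow> nat \<Rightarrow> nat) \<Rightarrow>
   (nat \<Rightarrow> (nat \<Rightarrow> nat) \<Rightarrow> nat \<Rightarrow> server \<Rightarrow> nat) \<Rightarrow> ivalues \<Rightarrow> real" where
  "communication_load k q Q B ord elt lab \<nu> =
     real (\<Sum>x\<in>transmissions k q Q ord. length (sent k q Q B ord elt lab \<nu> x)) /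
     (real Q * real (q^(k-1)) * real B)"

end

theory Submission
  imports Defs
begin

text \<open>
  The columns of the matrix are the words \<open>c \<in> \<int>\<^sub>q\<^sup>k\<close> with \<open>c 1 + \<dots> + c (k-1) - c k = 0\<close>. Every
  coefficient of this check is a unit, so a column is determined by any \<open>k - 1\<close> of its entries, which
  can be prescribed freely. Hence the groups are exactly the \<open>q\<^sup>k - q\<^sup>k\<^sup>-\<^sup>1\<close> tuples that violate the
  check. If server \<open>(i, l)\<close> misses the subfile \<open>n\<close>, then replacing entry \<open>i\<close> of column \<open>n\<close> by \<open>l\<close> gives a
  group whose \<open>i\<close>-th requested subfile is \<open>n\<close>; all other subfiles requested in that group lie in
  the block of \<open>(i, l)\<close>, so each message received in the group reveals one part of the missing value.
\<close>

section \<open>The single parity check code\<close>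

text \<open>The check is evaluated in \<open>int\<close>, so that the coefficient -1 of the last
  entry is not truncated. Extensionality makes a word determined by its entries in
  \<open>{1..k}\<close>, so that words can be counted and compared as functions.\<close>

definition codewords :: "nat \<Rightarrow> nat \<Rightarrow> (nat \<Rightarrow> nat) set" where
  "codewords k q = {c \<in> {1..k} \<rightarrow>\<^sub>E {0..<q}.
     int q dvd (\<Sum>i\<in>{1..k}. (if i = k then -1 else 1) * int (c i))}"

lemma codeword_systematic:
  assumes "i \<in> {1..k-1}"
  shows "codeword k q u i = u i mod q"
proof -
  have "i \<noteq> k" using assms by auto
  then have "(\<Sum>a\<in>{1..k-1}. u a * spc_gen k a i) = (\<Sum>a\<in>{1..k-1}. if a = i then u a else 0)"
    by (intro sum.cong) (auto simp: spc_gen_def)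
  then show ?thesis using assms by (simp add: codeword_def)
qed

lemma codeword_parity: "codeword k q u k = (\<Sum>a\<in>{1..k-1}. u a) mod q"
  by (simp add: codeword_def spc_gen_def)

lemma sum_check_split:
  fixes c :: "nat \<Rightarrow> nat"
  assumes "k \<ge> 1"
  shows "(\<Sum>i\<in>{1..k}. (if i = k then -1 else 1) * int (c i)) = int (\<Sum>i\<in>{1..k-1}. c i) - int (c k)"
proof -
  have "{1..k} = insert k {1..k-1}" using assms by auto
  moreover have "(\<Sum>i\<in>{1..k-1}. (if i = k then -1 else 1) * int (c i)) = (\<Sum>i\<in>{1..k-1}. int (c i))"
    using assms by (intro sum.cong) auto
  moreover have "k \<notin> {1..k-1}" using assms by auto
  ultimately show ?thesis by simp
qed

text \<open>Since \<open>c k < q\<close>, the last entry is its own residue, and the congruence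
  expressed by the check becomes an equality of natural numbers.\<close>

lemma mem_codewords_iff:
  assumes "k \<ge> 1" "c \<in> {1..k} \<rightarrow>\<^sub>E {0..<q}"
  shows "c \<in> codewords k q \<longleftrightarrow> c k = (\<Sum>i\<in>{1..k-1}. c i) mod q"
proof -
  have "c k < q" using assms by (auto simp: PiE_iff)
  then have "c k = (\<Sum>i\<in>{1..k-1}. c i) mod q \<longleftrightarrow>
      int (\<Sum>i\<in>{1..k-1}. c i) mod int q = int (c k) mod int q"
    by (metis mod_less of_nat_eq_iff zmod_int)
  then show ?thesis
    using assms(2) unfolding codewords_def mem_Collect_eq sum_check_split[OF assms(1)] mod_eq_dvd_iff
    by blast
qed

text \<open>The generator matrix is systematic: the first \<open>k - 1\<close> entries of a codeword
  repeat the information vector, so dropping the last entry inverts the encoding, and the check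
  restores that entry.\<close>

lemma bij_betw_codeword:
  assumes "k \<ge> 1" "q > 0"
  shows "bij_betw (\<lambda>u. restrict (codeword k q u) {1..k}) (info_vectors k q) (codewords k q)"
proof (rule bij_betw_byWitness[where f' = "\<lambda>c. restrict c {1..k-1}"])
  show "\<forall>u\<in>info_vectors k q. restrict (restrict (codeword k q u) {1..k}) {1..k-1} = u"
  proof
    fix u assume u: "u \<in> info_vectors k q"
    have "(restrict (restrict (codeword k q u) {1..k}) {1..k-1}) i = u i" for i
    proof (cases "i \<in> {1..k-1}")
      case True
      then have "u i < q" "i \<le> k" using u by (auto simp: info_vectors_def PiE_iff)
      then show ?thesis using True by (auto simp: codeword_systematic)
    next
      case False
      then have "u i = undefined" using u by (auto simp: info_vectors_def PiE_def extensional_def)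
      then show ?thesis using False by (simp only: restrict_apply if_False)
    qed
    then show "restrict (restrict (codeword k q u) {1..k}) {1..k-1} = u" by blast
  qed
  show "\<forall>c\<in>codewords k q. restrict (codeword k q (restrict c {1..k-1})) {1..k} = c"
  proof
    fix c assume c: "c \<in> codewords k q"
    then have cP: "c \<in> {1..k} \<rightarrow>\<^sub>E {0..<q}" by (simp add: codewords_def)
    have ck: "c k = (\<Sum>i\<in>{1..k-1}. c i) mod q"
      using c mem_codewords_iff[OF assms(1) cP] by simp
    have "restrict (codeword k q (restrict c {1..k-1})) {1..k} i = c i" for i
    proof -
      consider "i = k" | "i \<in> {1..k-1}" | "i \<notin> {1..k}" by force
      then show ?thesis
      proof cases
        case 1 then show ?thesis using assms ck by (simp add: codeword_parity)
      next
        case 2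
        then have "c i < q" "i \<in> {1..k}" using cP by (auto simp: PiE_iff)
        then show ?thesis using 2 by (simp add: codeword_systematic)
      next
        case 3 then show ?thesis using cP by (auto simp: PiE_def extensional_def)
      qed
    qed
    then show "restrict (codeword k q (restrict c {1..k-1})) {1..k} = c" by blast
  qed
  show "(\<lambda>u. restrict (codeword k q u) {1..k}) ` info_vectors k q \<subseteq> codewords k q"
  proof (rule image_subsetI)
    fix u
    have P: "restrict (codeword k q u) {1..k} \<in> {1..k} \<rightarrow>\<^sub>E {0..<q}"
      using assms by (auto simp: codeword_def)
    have "(\<Sum>i\<in>{1..k-1}. restrict (codeword k q u) {1..k} i) mod q = (\<Sum>i\<in>{1..k-1}. u i mod q) mod q"
      using codeword_systematic by (intro arg_cong[where f = "\<lambda>x. x mod q"] sum.cong) auto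
    then have "(\<Sum>i\<in>{1..k-1}. restrict (codeword k q u) {1..k} i) mod q = codeword k q u k"
      by (simp only: codeword_parity mod_sum_eq)
    then show "restrict (codeword k q u) {1..k} \<in> codewords k q"
      unfolding mem_codewords_iff[OF assms(1) P] using assms(1) by simp
  qed
  show "(\<lambda>c. restrict c {1..k-1}) ` codewords k q \<subseteq> info_vectors k q"
    by (auto simp: codewords_def info_vectors_def PiE_iff)
qed

text \<open>Composing the listing \<open>ord\<close> with the encoding shows that the columns run
  through the code without repetition. Later arguments can thus pass between subfile indices and
  codewords.\<close>

lemma bij_betw_columns:
  assumes "k \<ge> 1" "q > 0" "bij_betw ord {1..q^(k-1)} (info_vectors k q)"
  shows "bij_betw (\<lambda>j. restrict (\<lambda>i. code_matrix k q ord i j) {1..k}) {1..q^(k-1)} (codewords k q)"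
  using bij_betw_trans[OF assms(3) bij_betw_codeword[OF assms(1,2)]]
  by (simp add: comp_def code_matrix_def)

section \<open>Free entries, block intersections and groups\<close>

lemma ex1_codeword_update:
  assumes "q > 0" "G \<in> {1..k} \<rightarrow>\<^sub>E {0..<q}" "l \<in> {1..k}"
  shows "\<exists>!x. x < q \<and> G(l := x) \<in> codewords k q"
proof -
  define w :: "nat \<Rightarrow> int" where "w i = (if i = k then -1 else 1)" for i
  define S where "S = (\<Sum>i\<in>{1..k} - {l}. w i * int (G i))"
  have sum: "(\<Sum>i\<in>{1..k}. w i * int ((G(l := x)) i)) = w l * int x + S" for x
  proof -
    have "(\<Sum>i\<in>{1..k} - {l}. w i * int ((G(l := x)) i)) = S"
      unfolding S_def by (rule sum.cong) auto
    moreover have "(\<Sum>i\<in>{1..k}. w i * int ((G(l := x)) i)) =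
        w l * int ((G(l := x)) l) + (\<Sum>i\<in>{1..k} - {l}. w i * int ((G(l := x)) i))"
      by (rule sum.remove) (use assms(3) in simp_all)
    ultimately show ?thesis by (simp only: fun_upd_same)
  qed
  have w: "w l * w l = 1" and w_unit: "w l = 1 \<or> w l = -1" by (simp_all add: w_def)
  \<comment> \<open>The residue solving \<open>w l * x + S = 0\<close> modulo \<open>q\<close>: the
    coefficient \<open>w l\<close> is 1 or -1, hence its own inverse.\<close>
  define r where "r = (- w l * S) mod int q"
  have r: "0 \<le> r" "r < int q" using assms(1) by (simp_all add: r_def)
  have iff: "G(l := x) \<in> codewords k q \<longleftrightarrow> x = nat r" if "x < q" for x
  proof -
    have "G(l := x) \<in> {1..k} \<rightarrow>\<^sub>E {0..<q}" using assms that by (auto simp: PiE_iff extensional_def)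
    then have "G(l := x) \<in> codewords k q \<longleftrightarrow> int q dvd w l * int x + S"
      unfolding codewords_def sum[symmetric] by (simp add: w_def)
    also have "\<dots> \<longleftrightarrow> int q dvd w l * (w l * int x + S)"
      using w_unit by (elim disjE) (simp_all only: mult_1_left mult_minus1 dvd_minus_iff)
    also have "\<dots> \<longleftrightarrow> int q dvd int x - (- w l * S)"
      using w by (simp add: distrib_left flip: mult.assoc)
    also have "\<dots> \<longleftrightarrow> int x mod int q = r" by (simp add: r_def mod_eq_dvd_iff)
    also have "\<dots> \<longleftrightarrow> x = nat r"
      using that r(1) by auto
    finally show ?thesis .
  qed
  have "nat r < q" using r by linarith
  then show ?thesis using iff by blast
qed

text \<open>A column lies in the intersection iff it agrees with \<open>G\<close> off
  \<open>l\<close>. Exactly one codeword does so, by \<open>ex1_codeword_update\<close>, and it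
  occurs as exactly one column.\<close>

lemma ex1_column_agreeing_off:
  assumes "k \<ge> 2" "q > 0" "bij_betw ord {1..q^(k-1)} (info_vectors k q)"
    and G: "G \<in> {1..k} \<rightarrow>\<^sub>E {0..<q}" and l: "l \<in> {1..k}"
  obtains n where "(\<Inter>m\<in>{1..k} - {l}. block k q ord (m, G m)) = {n}" "n \<in> {1..q^(k-1)}"
proof -
  let ?col = "\<lambda>j. restrict (\<lambda>i. code_matrix k q ord i j) {1..k}"
  have bij: "bij_betw ?col {1..q^(k-1)} (codewords k q)"
    using assms by (intro bij_betw_columns) auto
  obtain x where x: "x < q" "G(l := x) \<in> codewords k q"
    and x': "\<And>y. y < q \<Longrightarrow> G(l := y) \<in> codewords k q \<Longrightarrow> y = x"
    using ex1_codeword_update[OF assms(2) G l] by blast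
  have "G(l := x) \<in> ?col ` {1..q^(k-1)}"
    unfolding bij_betw_imp_surj_on[OF bij] by (rule x(2))
  then obtain n where n: "G(l := x) = ?col n" "n \<in> {1..q^(k-1)}"
    by (rule imageE)
  \<comment> \<open>As \<open>k \<ge> 2\<close>, the intersection is over a nonempty family; an
    empty one would be \<open>UNIV\<close> and would not confine \<open>j\<close> to the subfile
    indices.\<close>
  obtain m0 where m0: "m0 \<in> {1..k} - {l}"
  proof
    show "(if l = 1 then 2 else 1) \<in> {1..k} - {l}" using assms(1) by simp
  qed
  have "n \<in> block k q ord (m, G m)" if "m \<in> {1..k} - {l}" for m
    using n(2) fun_cong[OF n(1), of m] that by (auto simp: block_def)
  moreover have "j = n" if j: "j \<in> (\<Inter>m\<in>{1..k} - {l}. block k q ord (m, G m))" for j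
  proof -
    have jN: "j \<in> {1..q^(k-1)}" using j m0 by (auto simp: block_def)
    define y where "y = code_matrix k q ord l j"
    have "?col j = G(l := y)"
    proof
      fix i show "?col j i = (G(l := y)) i"
        using j G l by (auto simp: block_def y_def restrict_apply PiE_def extensional_def)
    qed
    moreover have "?col j \<in> codewords k q" using bij jN by (auto simp: bij_betw_def)
    moreover have "y < q" using assms(2) by (simp add: y_def code_matrix_def codeword_def)
    ultimately have "y = x" using x' by simp
    then have "?col j = ?col n" using \<open>?col j = G(l := y)\<close> n(1) by simp
    with bij_betw_imp_inj_on[OF bij] show "j = n" using jN n(2) by (rule inj_onD)
  qed
  ultimately have "(\<Inter>m\<in>{1..k} - {l}. block k q ord (m, G m)) = {n}" by blast
  then show ?thesis using that n(2) by blast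
qed

text \<open>A common element of all \<open>k\<close> blocks is precisely the index of a column equal
  to \<open>G\<close>, so the intersection is empty iff \<open>G\<close> is not a column.\<close>

lemma groups_eq_noncodewords:
  assumes "k \<ge> 1" "q > 0" "bij_betw ord {1..q^(k-1)} (info_vectors k q)"
  shows "groups k q ord = ({1..k} \<rightarrow>\<^sub>E {0..<q}) - codewords k q"
proof -
  let ?col = "\<lambda>j. restrict (\<lambda>i. code_matrix k q ord i j) {1..k}"
  have col: "?col ` {1..q^(k-1)} = codewords k q"
    using bij_betw_columns[OF assms] by (simp add: bij_betw_def)
  have iff: "j \<in> (\<Inter>i\<in>{1..k}. block k q ord (i, G i)) \<longleftrightarrow> j \<in> {1..q^(k-1)} \<and> ?col j = G"
    if G: "G \<in> {1..k} \<rightarrow>\<^sub>E {0..<q}" for G j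
  proof
    assume j: "j \<in> (\<Inter>i\<in>{1..k}. block k q ord (i, G i))"
    have "?col j i = G i" for i
      using j G by (auto simp: block_def restrict_apply PiE_def extensional_def)
    moreover have "1 \<in> {1..k}" using assms(1) by simp
    then have "j \<in> block k q ord (1, G 1)" using j by blast
    ultimately show "j \<in> {1..q^(k-1)} \<and> ?col j = G" by (auto simp: block_def)
  qed (auto simp: block_def)
  have "(\<Inter>i\<in>{1..k}. block k q ord (i, G i)) = {} \<longleftrightarrow> G \<notin> codewords k q"
    if G: "G \<in> {1..k} \<rightarrow>\<^sub>E {0..<q}" for G
  proof -
    have "(\<Inter>i\<in>{1..k}. block k q ord (i, G i)) = {j \<in> {1..q^(k-1)}. ?col j = G}"
      using iff[OF G] by blast
    moreover have "G \<in> codewords k q \<longleftrightarrow> (\<exists>j\<in>{1..q^(k-1)}. ?col j = G)"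
      unfolding col[symmetric] by (simp only: image_iff eq_commute)
    ultimately show ?thesis by (simp only: Collect_empty_eq Bex_def not_ex not_not)
  qed
  then show ?thesis unfolding groups_def by auto
qed

lemma card_groups:
  assumes "k \<ge> 1" "q > 0" "bij_betw ord {1..q^(k-1)} (info_vectors k q)"
  shows "card (groups k q ord) = q^k - q^(k-1)"
proof -
  have "card (codewords k q) = q^(k-1)"
    using bij_betw_same_card[OF bij_betw_columns[OF assms]] by simp
  moreover have "finite ({1..k} \<rightarrow>\<^sub>E {0..<q})" "codewords k q \<subseteq> {1..k} \<rightarrow>\<^sub>E {0..<q}"
    by (auto intro!: finite_PiE simp: codewords_def)
  ultimately show ?thesis
    by (simp add: groups_eq_noncodewords[OF assms] card_Diff_subset finite_subset card_PiE)
qed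

section \<open>Computation load and communication load\<close>

text \<open>The blocks of one row partition the subfiles: in row \<open>i\<close>, the subfile
  \<open>n\<close> lies only in the block given by entry \<open>i\<close> of its column. This gives
  one server per row.\<close>

lemma card_assigned_servers:
  assumes "q > 0" "n \<in> {1..q^(k-1)}"
  shows "card (assigned_servers k q ord n) = k"
proof -
  have "assigned_servers k q ord n = (\<lambda>i. (i, code_matrix k q ord i n)) ` {1..k}"
    using assms by (auto simp: assigned_servers_def servers_def block_def code_matrix_def codeword_def)
  then show ?thesis by (simp add: card_image inj_on_def)
qed

text \<open>In each of the \<open>Q div (k*q)\<close> rounds, every group sends \<open>k\<close>
  messages of \<open>B div (k-1)\<close> bits, whatever the intermediate values are.\<close>

lemma communication_load_eq:
  assumes "k \<ge> 2" "q > 0" "Q > 0" "k * q dvd Q" "B > 0" "(k - 1) dvd B"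
    and "bij_betw ord {1..q^(k-1)} (info_vectors k q)"
  shows "communication_load k q Q B ord elt lab \<nu> = 1 / (real k - 1) * (1 - real k / real (k * q))"
proof -
  obtain a b where a: "Q = k * q * a" and b: "B = (k - 1) * b" using assms by (auto elim!: dvdE)
  have pos: "a > 0" "b > 0" "k - 1 > 0" using assms a b by auto
  have len: "length (sent k q Q B ord elt lab \<nu> x) = b" for x
    using pos by (simp add: sent_def message_def b split: prod.split)
  have "card (transmissions k q Q ord) = a * ((q^k - q^(k-1)) * k)"
    using assms card_groups[of k q ord]
    by (simp add: transmissions_def card_cartesian_product a)
  moreover have "q^k - q^(k-1) = q^(k-1) * (q - 1)"
    using assms(1) by (cases k) (simp_all add: algebra_simps)
  ultimately have "(\<Sum>x\<in>transmissions k q Q ord. length (sent k q Q B ord elt lab \<nu> x)) =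
      a * (q^(k-1) * (q - 1) * k) * b"
    by (simp add: len)
  \<comment> \<open>With \<open>Q\<close> and \<open>B\<close> written through \<open>a\<close> and
    \<open>b\<close>, the factors \<open>a\<close>, \<open>b\<close>, \<open>k\<close> and
    \<open>q^(k-1)\<close> cancel.\<close>
  then have "communication_load k q Q B ord elt lab \<nu> =
      (real a * (real (q^(k-1)) * (real q - 1) * real k) * real b) /
      (real k * real q * real a * real (q^(k-1)) * ((real k - 1) * real b))"
    unfolding communication_load_def using assms(1,2) by (simp add: a b of_nat_diff)
  also have "\<dots> = (real q - 1) / (real q * (real k - 1))"
    using assms(1,2) pos by (simp add: divide_simps)
  also have "\<dots> = 1 / (real k - 1) * (1 - real k / real (k * q))"
    using assms(1,2) by (simp add: divide_simps)
  finally show ?thesis .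
qed

section \<open>Decoding\<close>

text \<open>Turns the existence of a decoder into a uniqueness question: \<open>d\<close> evaluates
  \<open>h\<close> at any chosen point of the joint fibre of \<open>f\<close> and \<open>g\<close>,
  and \<open>h\<close> is constant there.\<close>

lemma ex_factor_through:
  assumes "\<And>x y. x \<in> A \<Longrightarrow> y \<in> A \<Longrightarrow> f x = f y \<Longrightarrow> g x = g y \<Longrightarrow> h x = h y"
  shows "\<exists>d. \<forall>x\<in>A. d (f x) (g x) = h x"
proof -
  define d where "d a b = h (SOME x. x \<in> A \<and> f x = a \<and> g x = b)" for a b
  have "d (f x) (g x) = h x" if "x \<in> A" for x
  proof -
    have "\<exists>y. y \<in> A \<and> f y = f x \<and> g y = g x" using that by blast
    from someI_ex[OF this] show ?thesis unfolding d_def using assms that by blast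
  qed
  then show ?thesis by blast
qed

lemma list_eq_if_parts_eq:
  assumes len: "length v = c * b" "length v' = c * b"
    and parts: "\<And>p t. p \<in> {1..c} \<Longrightarrow> t < b \<Longrightarrow> part b p v ! t = part b p v' ! t"
  shows "v = v'"
proof (rule nth_equalityI)
  fix x assume "x < length v"
  then have x: "x < c * b" using len by simp
  then have "b > 0" by (cases b) auto
  then have t: "x mod b < b" and p: "x div b < c"
    using x by (simp_all add: div_less_iff_less_mult)
  have "x div b * b \<le> x" by simp
  then have le: "x div b * b \<le> c * b" using x by linarith
  \<comment> \<open>Parts are numbered from 1, hence the \<open>+ 1\<close>. The bound
    \<open>le\<close> keeps the dropped prefix within the list.\<close>
  have "part b (x div b + 1) u ! (x mod b) = u ! x" if "length u = c * b" for u :: "'a list"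
    using t le that by (simp add: part_def)
  then show "v ! x = v' ! x"
    using parts[of "x div b + 1" "x mod b"] t p len by simp
qed (simp add: len)

text \<open>The uniqueness required by \<open>ex_factor_through\<close>: the messages are compared
  for two tables that look alike to \<open>s\<close>, instead of being solved for the missing
  value.\<close>

lemma decoding_unique:
  assumes "k \<ge> 2" "q > 0" "(k - 1) dvd B"
    and bij: "bij_betw ord {1..q^(k-1)} (info_vectors k q)"
    and ra: "reduce_assignment k q Q phi elt" and el: "edge_labeling k q Q ord lab"
    and s: "s \<in> servers k q"
    and iv: "\<nu> \<in> intermediate_values k q Q B" "\<nu>' \<in> intermediate_values k q Q B"
    and mp: "map_phase k q Q ord s \<nu> = map_phase k q Q ord s \<nu>'"
    and rc: "received k q Q B ord elt lab s \<nu> = received k q Q B ord elt lab s \<nu>'"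
    and j: "j \<in> phi s" and n: "n \<in> {1..q^(k-1)}"
  shows "\<nu> (j, n) = \<nu>' (j, n)"
proof -
  have known: "\<nu> (j', n') = \<nu>' (j', n')" if "j' \<in> {1..Q}" "n' \<in> block k q ord s" for j' n'
    using fun_cong[OF mp, of "(j', n')"] that by (simp add: map_phase_def)
  have phiQ: "phi s' \<subseteq> {1..Q}" if "s' \<in> servers k q" for s'
    using ra that by (auto simp: reduce_assignment_def)
  have jQ: "j \<in> {1..Q}" using phiQ[OF s] j by blast
  show ?thesis
  proof (cases "n \<in> block k q ord s")
    case True
    then show ?thesis using known jQ by blast
  next
    case False
    obtain i l where il: "s = (i, l)" by fastforce
    then have i: "i \<in> {1..k}" and l: "l < q" using s by (auto simp: servers_def)
    define G where "G = (restrict (\<lambda>m. code_matrix k q ord m n) {1..k})(i := l)"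
    have GP: "G \<in> {1..k} \<rightarrow>\<^sub>E {0..<q}"
      using i l assms(2) by (auto simp: G_def PiE_iff extensional_def code_matrix_def codeword_def)
    have Gi: "G i = l" by (simp add: G_def)
    have nG: "n \<in> block k q ord (m, G m)" if "m \<in> {1..k} - {i}" for m
      using that n by (auto simp: G_def block_def)
    \<comment> \<open>The intersection off \<open>i\<close> is a singleton and contains
      \<open>n\<close>, so the value requested by \<open>s\<close> in this group concerns
      \<open>n\<close>.\<close>
    obtain n0 where "(\<Inter>m\<in>{1..k} - {i}. block k q ord (m, G m)) = {n0}"
      using ex1_column_agreeing_off[OF assms(1,2) bij GP i] by blast
    moreover from this nG have "n = n0" by (metis INT_I singletonD)
    ultimately have ni: "(\<Inter>m\<in>{1..k} - {i}. block k q ord (m, G m)) = {n}" by simp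
    have "(\<Inter>m\<in>{1..k}. block k q ord (m, G m)) = {}"
    \<comment> \<open>By \<open>ni\<close> a common element could only be \<open>n\<close>, which
      \<open>s\<close> misses.\<close>
    proof -
      have "n \<notin> block k q ord (i, G i)" using False Gi il by simp
      then show ?thesis using ni i by blast
    qed
    then have Gg: "G \<in> groups k q ord" using GP by (simp add: groups_def)
    have srv: "(m, G m) \<in> servers k q" if "m \<in> {1..k}" for m
      using GP that by (auto simp: servers_def PiE_iff)
    have eltbij: "bij_betw (elt s') {1..Q div (k*q)} (phi s')" if "s' \<in> servers k q" for s'
      using ra that by (simp add: reduce_assignment_def)
    obtain \<gamma> where \<gamma>: "\<gamma> \<in> {1..Q div (k*q)}" "elt s \<gamma> = j"
      using eltbij[OF s] j unfolding bij_betw_imp_surj_on[OF eltbij[OF s], symmetric] by blast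
    have di: "delta_index k q ord elt \<gamma> G i = (j, n)"
      using \<gamma>(2) Gi il ni by (simp add: delta_index_def)
    \<comment> \<open>Each requested value is known to all other members of the group. For a sender
      this shows that \<open>map_phase\<close> does not alter the summands of its message; for
      \<open>s\<close> it makes all summands but its own request known.\<close>
    have dm: "delta_index k q ord elt \<gamma> G m' \<in> {1..Q} \<times> block k q ord (m, G m)"
      if m': "m' \<in> {1..k}" and m: "m \<in> {1..k}" "m \<noteq> m'" for m m'
    proof -
      obtain n' where n': "(\<Inter>m\<in>{1..k} - {m'}. block k q ord (m, G m)) = {n'}"
        using ex1_column_agreeing_off[OF assms(1,2) bij GP m'] by blast
      then have "n' \<in> block k q ord (m, G m)" using m by blast
      moreover have "elt (m', G m') \<gamma> \<in> {1..Q}"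
        using bij_betwE[OF eltbij[OF srv[OF m']]] phiQ[OF srv[OF m']] \<gamma>(1) by blast
      ultimately show ?thesis unfolding delta_index_def n' the_elem_eq by blast
    qed
    obtain b where b: "B = (k - 1) * b" using assms(3) by (auto elim: dvdE)
    have bdiv: "B div (k - 1) = b" using assms(1) b by simp
    let ?P = "\<lambda>\<mu> m m'. part b (lab \<gamma> G m' (m, G m)) (\<mu> (delta_index k q ord elt \<gamma> G m'))"
    have sent_nth: "sent k q Q B ord elt lab \<mu> (\<gamma>, G, m) ! t = (\<Sum>m'\<in>{1..k} - {m}. ?P \<mu> m m' ! t)"
      if "m \<in> {1..k}" "t < b" for \<mu> m t
    proof -
      have "map_phase k q Q ord (m, G m) \<mu> (delta_index k q ord elt \<gamma> G m') =
          \<mu> (delta_index k q ord elt \<gamma> G m')" if "m' \<in> {1..k} - {m}" for m'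
        using dm[of m' m] that \<open>m \<in> {1..k}\<close> by (auto simp: map_phase_def)
      then show ?thesis using that(2) bdiv by (simp add: sent_def message_def)
    qed
    \<comment> \<open>The two messages from \<open>m\<close> agree, and so do the summands known to
      \<open>s\<close>. Cancelling these leaves the part of the missing value that is labelled by
      \<open>m\<close>.\<close>
    have part_eq: "?P \<nu> m i ! t = ?P \<nu>' m i ! t" if m: "m \<in> {1..k} - {i}" and t: "t < b" for m t
    proof -
      have "(\<gamma>, G, m) \<in> transmissions k q Q ord" using \<gamma>(1) Gg m by (simp add: transmissions_def)
      moreover have "s \<in> members k G" using i Gi il by (auto simp: members_def)
      moreover have "s \<noteq> (m, G m)" using il m by auto
      ultimately have "sent k q Q B ord elt lab \<nu> (\<gamma>, G, m) = sent k q Q B ord elt lab \<nu>' (\<gamma>, G, m)"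
        using fun_cong[OF rc, of "(\<gamma>, G, m)"] by (simp add: received_def)
      then have eq: "(\<Sum>m'\<in>{1..k} - {m}. ?P \<nu> m m' ! t) = (\<Sum>m'\<in>{1..k} - {m}. ?P \<nu>' m m' ! t)"
        unfolding sent_nth[OF DiffD1[OF m] t, symmetric] by (rule arg_cong)
      have rest: "(\<Sum>m'\<in>{1..k} - {m} - {i}. ?P \<nu> m m' ! t) = (\<Sum>m'\<in>{1..k} - {m} - {i}. ?P \<nu>' m m' ! t)"
      proof (rule sum.cong)
        fix m' assume "m' \<in> {1..k} - {m} - {i}"
        then have "delta_index k q ord elt \<gamma> G m' \<in> {1..Q} \<times> block k q ord s"
          using dm[of m' i] i Gi il by auto
        then have "\<nu> (delta_index k q ord elt \<gamma> G m') = \<nu>' (delta_index k q ord elt \<gamma> G m')"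
          using known by auto
        then show "?P \<nu> m m' ! t = ?P \<nu>' m m' ! t" by simp
      qed simp
      have split: "(\<Sum>m'\<in>{1..k} - {m}. ?P \<mu> m m' ! t) =
          ?P \<mu> m i ! t + (\<Sum>m'\<in>{1..k} - {m} - {i}. ?P \<mu> m m' ! t)" for \<mu>
        by (rule sum.remove) (use i m in auto)
      show ?thesis using eq unfolding split rest by (rule add_right_imp_eq)
    qed
    \<comment> \<open>Surjectivity of the labeling is what counts: the \<open>k - 1\<close> other
      members together deliver every part.\<close>
    have lab: "bij_betw (lab \<gamma> G i) (members k G - {(i, G i)}) {1..k-1}"
      using el \<gamma>(1) Gg i by (simp add: edge_labeling_def)
    show ?thesis
    proof (rule list_eq_if_parts_eq)
      show "length (\<nu> (j, n)) = (k - 1) * b" "length (\<nu>' (j, n)) = (k - 1) * b"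
        using iv jQ n b by (auto simp: intermediate_values_def)
    next
      fix p t assume "p \<in> {1..k-1}" and t: "t < b"
      then obtain s' where "s' \<in> members k G - {(i, G i)}" and p: "p = lab \<gamma> G i s'"
        unfolding bij_betw_imp_surj_on[OF lab, symmetric] by blast
      then obtain m where "m \<in> {1..k} - {i}" "s' = (m, G m)"
        unfolding members_def by blast
      then show "part b p (\<nu> (j, n)) ! t = part b p (\<nu>' (j, n)) ! t"
        using part_eq[of m t] t di p by simp
    qed
  qed
qed

section \<open>Assembly of the three claims\<close>

theorem mainTheorem1:
  fixes k q K Q N B :: nat
    and ord :: "nat \<Rightarrow> nat \<Rightarrow> nat"
    and phi :: "server \<Rightarrow> nat set"
    and elt :: "server \<Rightarrow> nat \<Rightarrow> nat"
    and lab :: "nat \<Rightarrow> (nat \<Rightarrow> nat) \<Rightarrow> nat \<Rightarrow> server \<Rightarrow> nat"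
  assumes "k \<ge> 2" and "q \<ge> 2"
    and "K = k * q"
    and "Q > 0" and "K dvd Q"
    and "N = q ^ (k - 1)"
    and "B > 0" and "(k - 1) dvd B"
    and "bij_betw ord {1..N} (info_vectors k q)"
    and "reduce_assignment k q Q phi elt"
    and "edge_labeling k q Q ord lab"
  shows "(\<forall>n\<in>{1..N}. card (assigned_servers k q ord n) = k) \<and>
    (\<forall>s\<in>servers k q. \<exists>decode :: ivalues \<Rightarrow> (transmission \<Rightarrow> bit list) \<Rightarrow> ivalues.
       \<forall>\<nu>\<in>intermediate_values k q Q B. \<forall>j\<in>phi s. \<forall>n\<in>{1..N}.
         decode (map_phase k q Q ord s \<nu>) (received k q Q B ord elt lab s \<nu>) (j, n) = \<nu> (j, n)) \<and>
    (\<forall>\<nu>\<in>intermediate_values k q Q B.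
       communication_load k q Q B ord elt lab \<nu> = 1 / (real k - 1) * (1 - real k / real K))"
proof (intro conjI ballI)
  have q: "q > 0" using \<open>q \<ge> 2\<close> by simp
  have bij: "bij_betw ord {1..q^(k-1)} (info_vectors k q)" using assms by simp
  show "card (assigned_servers k q ord n) = k" if "n \<in> {1..N}" for n
    using card_assigned_servers q that \<open>N = q ^ (k - 1)\<close> by blast
  show "communication_load k q Q B ord elt lab \<nu> = 1 / (real k - 1) * (1 - real k / real K)" for \<nu>
    using communication_load_eq assms q bij by simp
  show "\<exists>decode :: ivalues \<Rightarrow> (transmission \<Rightarrow> bit list) \<Rightarrow> ivalues.
       \<forall>\<nu>\<in>intermediate_values k q Q B. \<forall>j\<in>phi s. \<forall>n\<in>{1..N}.
         decode (map_phase k q Q ord s \<nu>) (received k q Q B ord elt lab s \<nu>) (j, n) = \<nu> (j, n)"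
    if s: "s \<in> servers k q" for s
  proof -
    \<comment> \<open>One decoder must serve all pairs \<open>(j, n)\<close>, so it returns a whole
      table. The table is restricted to the requested entries, whose uniqueness is what
      \<open>decoding_unique\<close> provides.\<close>
    have "\<exists>decode. \<forall>\<nu>\<in>intermediate_values k q Q B.
        decode (map_phase k q Q ord s \<nu>) (received k q Q B ord elt lab s \<nu>) =
        restrict \<nu> (phi s \<times> {1..N})"
    proof (rule ex_factor_through, rule restrict_ext)
      fix \<nu> \<nu>' x
      assume A: "\<nu> \<in> intermediate_values k q Q B" "\<nu>' \<in> intermediate_values k q Q B"
        "map_phase k q Q ord s \<nu> = map_phase k q Q ord s \<nu>'"
        "received k q Q B ord elt lab s \<nu> = received k q Q B ord elt lab s \<nu>'"
        and "x \<in> phi s \<times> {1..N}"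
      then obtain j n where "x = (j, n)" "j \<in> phi s" "n \<in> {1..q^(k-1)}"
        using \<open>N = q ^ (k - 1)\<close> by blast
      then show "\<nu> x = \<nu>' x"
        using decoding_unique[OF \<open>k \<ge> 2\<close> q \<open>(k - 1) dvd B\<close> bij assms(10,11) s A] by simp
    qed
    then obtain decode where "\<forall>\<nu>\<in>intermediate_values k q Q B.
        decode (map_phase k q Q ord s \<nu>) (received k q Q B ord elt lab s \<nu>) =
        restrict \<nu> (phi s \<times> {1..N})" by blast
    then show ?thesis by (intro exI[of _ decode]) simp
  qed
qed

end
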